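(* For every positive integer $n$, all the (reduced simplicial) homology groups of $\Delta([n])$ with coefficients in $\mathbb{Z}$ are torsion-free.
   Context: Let $\mathbb{PP}$ be the set of prime powers $p^a$ ($p$ prime, $a\ge 1$) and $[n]=\{1,2,\dots,n\}$. $\Delta([n])$ is the simplicial complex whose vertex set is $[n]\cap\mathbb{PP}$ and in which a set $\sigma=\{q_1,\dots,q_s\}$ of prime powers is a simplex if and only if the $q_i$ are pairwise relatively prime and $q_1\cdots q_s\le n$ (the empty set is a simplex). *)

theory Defs
  imports
    "HOL-Algebra.Free_Abelian_Groups"
    "HOL-Number_Theory.Prime_Powers"
begin

definition is_simplicial_complex :: "'a set set \<Rightarrow> bool"
  where "is_simplicial_complex K \<longleftrightarrow>
    (\<forall>\<sigma>\<in>K. finite \<sigma>) \<and> (\<forall>\<sigma>\<in>K. \<forall>\<tau>. \<tau> \<subseteq> \<sigma> \<longrightarrow> \<tau> \<in> K)"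

(* The empty simplex has dimension -1, so the chain complex below is the augmented one and its
   homology is reduced homology. *)
definition simplices_of_dim :: "'a set set \<Rightarrow> int \<Rightarrow> 'a set set"
  where "simplices_of_dim K p = {\<sigma> \<in> K. int (card \<sigma>) = p + 1}"

definition simplicial_chain_group :: "'a set set \<Rightarrow> int \<Rightarrow> ('a set \<Rightarrow>\<^sub>0 int) monoid"
  where "simplicial_chain_group K p = free_Abelian_group (simplices_of_dim K p)"

(* Simplices are oriented by the linear order on the vertices: for v_0 < ... < v_p the boundary of
   {v_0,...,v_p} is the sum over i of (-1)^i times {v_0,...,v_p} - {v_i}. The index i of v is
   written as the number of vertices below v. *)
definition simplicial_boundary :: "('a::linorder set \<Rightarrow>\<^sub>0 int) \<Rightarrow> ('a set \<Rightarrow>\<^sub>0 int)"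
  where "simplicial_boundary =
    frag_extend (\<lambda>\<sigma>. \<Sum>v\<in>\<sigma>. frag_cmul ((-1) ^ card {u \<in> \<sigma>. u < v}) (frag_of (\<sigma> - {v})))"

definition simplicial_cycles :: "'a::linorder set set \<Rightarrow> int \<Rightarrow> ('a set \<Rightarrow>\<^sub>0 int) set"
  where "simplicial_cycles K p =
    kernel (simplicial_chain_group K p) (simplicial_chain_group K (p - 1)) simplicial_boundary"

definition simplicial_boundaries :: "'a::linorder set set \<Rightarrow> int \<Rightarrow> ('a set \<Rightarrow>\<^sub>0 int) set"
  where "simplicial_boundaries K p =
    simplicial_boundary ` carrier (simplicial_chain_group K (p + 1))"

definition reduced_simplicial_homology_group ::
    "'a::linorder set set \<Rightarrow> int \<Rightarrow> ('a set \<Rightarrow>\<^sub>0 int) set monoid"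
  where "reduced_simplicial_homology_group K p =
    subgroup_generated (simplicial_chain_group K p) (simplicial_cycles K p)
      Mod simplicial_boundaries K p"

definition torsion_free_group :: "('a, 'b) monoid_scheme \<Rightarrow> bool"
  where "torsion_free_group G \<longleftrightarrow>
    (\<forall>x \<in> carrier G. \<forall>m::nat. m > 0 \<longrightarrow> x [^]\<^bsub>G\<^esub> m = \<one>\<^bsub>G\<^esub> \<longrightarrow> x = \<one>\<^bsub>G\<^esub>)"

definition prime_power_complex :: "nat \<Rightarrow> nat set set"
  where "prime_power_complex n =
    {\<sigma>. \<sigma> \<subseteq> {1..n} \<inter> {q. primepow q} \<and> pairwise coprime \<sigma> \<and> \<Prod>\<sigma> \<le> n}"

lemma is_simplicial_complex_prime_power_complex:
  "is_simplicial_complex (prime_power_complex n)"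
  unfolding is_simplicial_complex_def
proof (intro conjI ballI allI impI)
  fix \<sigma> assume s: "\<sigma> \<in> prime_power_complex n"
  then have sub: "\<sigma> \<subseteq> {1..n}" by (auto simp: prime_power_complex_def)
  show fin: "finite \<sigma>" using sub by (rule finite_subset) simp
  fix \<tau> assume t: "\<tau> \<subseteq> \<sigma>"
  have "\<Prod>\<tau> dvd \<Prod>\<sigma>" using fin t by (rule prod_dvd_prod_subset)
  moreover have "\<Prod>\<sigma> > 0" using sub by (intro prod_pos) auto
  ultimately have "\<Prod>\<tau> \<le> \<Prod>\<sigma>" by (rule dvd_imp_le)
  with s t show "\<tau> \<in> prime_power_complex n"
    by (auto simp: prime_power_complex_def intro: pairwise_subset)
qed

lemma empty_in_prime_power_complex: "n > 0 \<Longrightarrow> {} \<in> prime_power_complex n"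
  by (simp add: prime_power_complex_def)

lemma vertex_in_prime_power_complex_iff:
  "{q} \<in> prime_power_complex n \<longleftrightarrow> primepow q \<and> q \<in> {1..n}"
  by (auto simp: prime_power_complex_def)

lemma simplicial_boundary_add:
  "simplicial_boundary (a + b) = simplicial_boundary a + simplicial_boundary b"
  by (simp add: simplicial_boundary_def frag_extend_add)

lemma simplicial_boundary_hom:
  assumes K: "is_simplicial_complex K"
  shows "simplicial_boundary \<in> hom (simplicial_chain_group K p) (simplicial_chain_group K (p - 1))"
proof (rule homI)
  fix c assume "c \<in> carrier (simplicial_chain_group K p)"
  then have c: "Poly_Mapping.keys c \<subseteq> simplices_of_dim K p"
    by (simp add: simplicial_chain_group_def)
  have face: "\<sigma> - {v} \<in> simplices_of_dim K (p - 1)"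
    if "\<sigma> \<in> simplices_of_dim K p" "v \<in> \<sigma>" for \<sigma> v
  proof -
    have "\<sigma> \<in> K" "int (card \<sigma>) = p + 1" using that by (auto simp: simplices_of_dim_def)
    moreover have "finite \<sigma>" using K \<open>\<sigma> \<in> K\<close> by (auto simp: is_simplicial_complex_def)
    moreover have "\<sigma> - {v} \<in> K" using K \<open>\<sigma> \<in> K\<close> unfolding is_simplicial_complex_def by blast
    moreover have "card \<sigma> > 0" using \<open>finite \<sigma>\<close> that by (auto simp: card_gt_0_iff)
    ultimately show ?thesis using that by (simp add: simplices_of_dim_def of_nat_diff)
  qed
  have cmul: "frag_cmul k x \<in> carrier (free_Abelian_group S)"
    if "x \<in> carrier (free_Abelian_group S)" for k and x :: "'a set \<Rightarrow>\<^sub>0 int" and S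
    using that keys_cmul[of k x] by auto
  show "simplicial_boundary c \<in> carrier (simplicial_chain_group K (p - 1))"
    unfolding simplicial_boundary_def simplicial_chain_group_def frag_extend_def
  proof (intro sum_closed_free_Abelian_group cmul)
    fix \<sigma> v assume "\<sigma> \<in> Poly_Mapping.keys c" "v \<in> \<sigma>"
    then show "frag_of (\<sigma> - {v}) \<in> carrier (free_Abelian_group (simplices_of_dim K (p - 1)))"
      using c face by auto
  qed
qed (simp add: simplicial_boundary_add simplicial_chain_group_def)

lemma simplicial_boundary_of:
  "simplicial_boundary (frag_of \<sigma>) =
    (\<Sum>v\<in>\<sigma>. frag_cmul ((-1) ^ card {u \<in> \<sigma>. u < v}) (frag_of (\<sigma> - {v})))"
  by (simp add: simplicial_boundary_def)

lemma simplicial_boundary_sum: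
  "simplicial_boundary (sum g I) = (\<Sum>i\<in>I. simplicial_boundary (g i))"
  by (induction I rule: infinite_finite_induct)
    (simp_all add: simplicial_boundary_add, simp_all add: simplicial_boundary_def)

lemma simplicial_boundary_cmul:
  "simplicial_boundary (frag_cmul k c) = frag_cmul k (simplicial_boundary c)"
  by (simp add: simplicial_boundary_def frag_extend_cmul)

lemma simplicial_boundary_boundary_of:
  assumes fin: "finite \<sigma>"
  shows "simplicial_boundary (simplicial_boundary (frag_of \<sigma>)) = 0"
proof -
  define s where "s \<rho> v = (-1::int) ^ card {u \<in> \<rho>. u < v}" for \<rho> :: "'a set" and v
  define t where "t v w = frag_cmul (s \<sigma> v * s (\<sigma> - {v}) w) (frag_of (\<sigma> - {v} - {w}))" for v w
  define A where "A = {(v, w). v \<in> \<sigma> \<and> w \<in> \<sigma> \<and> v < w}"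
  define B where "B = {(v, w). v \<in> \<sigma> \<and> w \<in> \<sigma> \<and> w < v}"
  have finAB: "finite A" "finite B"
    using fin by (auto intro: finite_subset[of _ "\<sigma> \<times> \<sigma>"] simp: A_def B_def)
  have disj: "A \<inter> B = {}"
    unfolding A_def B_def by (blast dest: order.asym)
  have anti: "t w v = - t v w" if "v \<in> \<sigma>" "w \<in> \<sigma>" "v < w" for v w
  proof -
    have "{u \<in> \<sigma> - {w}. u < v} = {u \<in> \<sigma>. u < v}" using that by auto
    then have 1: "s (\<sigma> - {w}) v = s \<sigma> v" by (simp add: s_def)
    have "{u \<in> \<sigma>. u < w} = insert v {u \<in> \<sigma> - {v}. u < w}" using that by auto
    then have 2: "s \<sigma> w = - s (\<sigma> - {v}) w" using fin by (simp add: s_def)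
    have 3: "\<sigma> - {w} - {v} = \<sigma> - {v} - {w}" by auto
    show ?thesis by (simp only: t_def 1 2 3 minus_frag_cmul) (simp add: mult.commute)
  qed
  have "simplicial_boundary (simplicial_boundary (frag_of \<sigma>)) =
      (\<Sum>v\<in>\<sigma>. \<Sum>w\<in>\<sigma> - {v}. t v w)"
    by (simp add: simplicial_boundary_of simplicial_boundary_sum simplicial_boundary_cmul
        frag_cmul_sum s_def t_def)
  also have "\<dots> = (\<Sum>(v, w)\<in>Sigma \<sigma> (\<lambda>v. \<sigma> - {v}). t v w)"
    using fin by (simp add: sum.Sigma)
  also have "Sigma \<sigma> (\<lambda>v. \<sigma> - {v}) = A \<union> B" by (auto simp: A_def B_def)
  also have "(\<Sum>(v, w)\<in>A \<union> B. t v w) = (\<Sum>(v, w)\<in>A. t v w) + (\<Sum>(v, w)\<in>B. t v w)"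
    using finAB disj by (rule sum.union_disjoint)
  also have "(\<Sum>(v, w)\<in>B. t v w) = (\<Sum>(v, w)\<in>A. t w v)"
    by (rule sum.reindex_bij_witness[where i = prod.swap and j = prod.swap])
      (auto simp: A_def B_def)
  also have "\<dots> = (\<Sum>(v, w)\<in>A. - t v w)"
    by (rule sum.cong) (auto simp: A_def anti)
  also have "\<dots> = - (\<Sum>(v, w)\<in>A. t v w)"
    by (simp add: sum_negf case_prod_unfold)
  finally show ?thesis by simp
qed

lemma simplicial_boundary_boundary:
  assumes K: "is_simplicial_complex K" and c: "c \<in> carrier (simplicial_chain_group K p)"
  shows "simplicial_boundary (simplicial_boundary c) = 0"
proof -
  have "Poly_Mapping.keys c \<subseteq> K"
    using c by (auto simp: simplicial_chain_group_def simplices_of_dim_def)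
  then show ?thesis
  proof (induction c rule: frag_induction)
    case zero
    show ?case by (simp add: simplicial_boundary_def)
  next
    case (one \<sigma>)
    then have "finite \<sigma>" using K by (auto simp: is_simplicial_complex_def)
    then show ?case by (rule simplicial_boundary_boundary_of)
  next
    case (diff a b)
    then show ?case by (simp add: simplicial_boundary_def frag_extend_diff)
  qed
qed

lemma comm_group_simplicial_chain_group: "comm_group (simplicial_chain_group K p)"
  by (simp add: simplicial_chain_group_def abelian_free_Abelian_group)

lemma group_hom_simplicial_boundary:
  assumes "is_simplicial_complex K"
  shows "group_hom (simplicial_chain_group K p) (simplicial_chain_group K (p - 1))
    simplicial_boundary"
  using simplicial_boundary_hom[OF assms]
  by (simp add: group_hom_def group_hom_axioms_def simplicial_chain_group_def)

lemma carrier_simplicial_cycle_group: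
  assumes "is_simplicial_complex K"
  shows "carrier (subgroup_generated (simplicial_chain_group K p) (simplicial_cycles K p)) =
    simplicial_cycles K p"
  unfolding simplicial_cycles_def
  by (rule subgroup.carrier_subgroup_generated_subgroup
      [OF group_hom.subgroup_kernel [OF group_hom_simplicial_boundary [OF assms]]])

lemma simplicial_boundaries_subset_cycles:
  assumes K: "is_simplicial_complex K"
  shows "simplicial_boundaries K p \<subseteq> simplicial_cycles K p"
proof
  fix x assume "x \<in> simplicial_boundaries K p"
  then obtain c where c: "c \<in> carrier (simplicial_chain_group K (p + 1))"
    and x: "x = simplicial_boundary c" by (auto simp: simplicial_boundaries_def)
  have "x \<in> carrier (simplicial_chain_group K p)"
    using simplicial_boundary_hom[OF K, of "p + 1"] c x by (auto simp: hom_def)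
  then show "x \<in> simplicial_cycles K p"
    using simplicial_boundary_boundary[OF K c] x
    by (simp add: simplicial_cycles_def kernel_def simplicial_chain_group_def)
qed

lemma simplicial_boundaries_normal:
  assumes K: "is_simplicial_complex K"
  shows "simplicial_boundaries K p \<lhd>
    subgroup_generated (simplicial_chain_group K p) (simplicial_cycles K p)"
proof -
  interpret C: comm_group "simplicial_chain_group K p"
    by (rule comm_group_simplicial_chain_group)
  have "subgroup (simplicial_boundaries K p) (simplicial_chain_group K p)"
    using group_hom.img_is_subgroup[OF group_hom_simplicial_boundary[OF K, of "p + 1"]]
    by (simp add: simplicial_boundaries_def)
  then have "subgroup (simplicial_boundaries K p)
      (subgroup_generated (simplicial_chain_group K p) (simplicial_cycles K p))"
    using simplicial_boundaries_subset_cycles[OF K]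
    by (simp add: C.subgroup_subgroup_generated_iff carrier_simplicial_cycle_group[OF K])
  then show ?thesis
    by (rule iffD2 [OF comm_group.normal_iff_subgroup
        [OF C.abelian_subgroup_generated [OF C.comm_group_axioms]]])
qed

lemma comm_group_reduced_simplicial_homology_group:
  assumes "is_simplicial_complex K"
  shows "comm_group (reduced_simplicial_homology_group K p)"
proof -
  interpret C: comm_group "simplicial_chain_group K p"
    by (rule comm_group_simplicial_chain_group)
  interpret Z: comm_group "subgroup_generated (simplicial_chain_group K p) (simplicial_cycles K p)"
    by (rule C.abelian_subgroup_generated [OF C.comm_group_axioms])
  show ?thesis
    unfolding reduced_simplicial_homology_group_def
    by (rule Z.abelian_FactGroup [OF normal_imp_subgroup
        [OF simplicial_boundaries_normal [OF assms]]])
qed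

end

theory Submission
  imports Defs
begin

text \<open>
  The reason is that vertices can be removed from the complex one at a time without creating
  torsion. Suppose \<open>v \<noteq> w\<close> are vertices of a complex \<open>K\<close> such that every simplex of the link of
  \<open>v\<close>, with \<open>w\<close> added, is still a simplex of \<open>K\<close>. Then the link of \<open>v\<close> bounds a cone inside the
  deletion \<open>K \<setminus> v\<close>, so that \<open>K\<close>, which is \<open>K \<setminus> v\<close> with a cone over the link attached, is
  homotopy equivalent to the wedge of \<open>K \<setminus> v\<close> and the suspension of the link. Its homology is
  therefore torsion-free if that of the deletion and that of the link is
  (\<open>pure_boundaries_dominated_vertex\<close>).

  To use this recursively, the product bound and the set \<open>S\<close> of admissible vertices are varied
  independently: \<open>coprime_complex S n\<close>. Deletions and links of a vertex \<open>v\<close> are again of this form,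
  the link with the bound \<open>n div v\<close>. Replacing \<open>v\<close> by a smaller \<open>w\<close> keeps the product below the
  bound, so \<open>w\<close> serves as above as soon as the vertices coprime to \<open>v\<close> are coprime to \<open>w\<close>. If
  two elements of \<open>S\<close> are powers of the same prime, they are such a pair; otherwise \<open>S\<close> is pairwise
  coprime and any two elements are (\<open>obtain_dominated_vertex\<close>). The recursion ends with at most
  one vertex.

  The wedge decomposition is carried out on chains, by the operators \<open>cone_over v\<close> (join with
  \<open>v\<close>) and \<open>contract_to_link v\<close> (its one-sided inverse, the projection onto the link). All
  dimensions are treated at once: torsion-freeness becomes the statement \<open>pure_boundaries\<close> that a
  chain with a nonzero multiple that is a boundary is a boundary itself.
\<close>

section \<open>Cone and contraction operators on chains\<close>

definition vertex_sign :: "'a::linorder set \<Rightarrow> 'a \<Rightarrow> int"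
  where "vertex_sign \<sigma> v = (-1) ^ card {u \<in> \<sigma>. u < v}"

text \<open>
  The sign is the one that moves \<open>v\<close> to the front of the orientation, so that the boundary has the
  front face with coefficient 1.
\<close>
definition cone_over :: "'a::linorder \<Rightarrow> ('a set \<Rightarrow>\<^sub>0 int) \<Rightarrow> ('a set \<Rightarrow>\<^sub>0 int)"
  where "cone_over v = frag_extend (\<lambda>\<sigma>.
    if v \<in> \<sigma> then 0 else frag_cmul (vertex_sign \<sigma> v) (frag_of (insert v \<sigma>)))"

definition contract_to_link :: "'a::linorder \<Rightarrow> ('a set \<Rightarrow>\<^sub>0 int) \<Rightarrow> ('a set \<Rightarrow>\<^sub>0 int)"
  where "contract_to_link v = frag_extend (\<lambda>\<sigma>.
    if v \<in> \<sigma> then frag_cmul (vertex_sign \<sigma> v) (frag_of (\<sigma> - {v})) else 0)"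

lemma vertex_sign_square [simp]: "vertex_sign \<sigma> v * vertex_sign \<sigma> v = 1"
  by (simp add: vertex_sign_def flip: power_mult_distrib)

lemma vertex_sign_remove_self [simp]: "vertex_sign (\<sigma> - {v}) v = vertex_sign \<sigma> v"
proof -
  have "{u \<in> \<sigma> - {v}. u < v} = {u \<in> \<sigma>. u < v}" by auto
  then show ?thesis by (simp add: vertex_sign_def)
qed

lemma vertex_sign_insert_self [simp]: "vertex_sign (insert v \<sigma>) v = vertex_sign \<sigma> v"
proof -
  have "{u \<in> insert v \<sigma>. u < v} = {u \<in> \<sigma>. u < v}" by auto
  then show ?thesis by (simp add: vertex_sign_def)
qed

text \<open>
  Removing the smaller of the two vertices lowers the position of the larger one by one and leaves
  that of the smaller one; hence the two orders of removal differ by a sign.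
\<close>
lemma vertex_sign_exchange:
  assumes "finite \<sigma>" "v \<in> \<sigma>" "w \<in> \<sigma>" "v \<noteq> w"
  shows "vertex_sign \<sigma> w * vertex_sign (\<sigma> - {w}) v =
    - (vertex_sign \<sigma> v * vertex_sign (\<sigma> - {v}) w)"
proof -
  have ordered: "vertex_sign \<sigma> y * vertex_sign (\<sigma> - {y}) x =
      - (vertex_sign \<sigma> x * vertex_sign (\<sigma> - {x}) y)"
    if "x \<in> \<sigma>" "y \<in> \<sigma>" "x < y" for x y
  proof -
    have "{u \<in> \<sigma> - {y}. u < x} = {u \<in> \<sigma>. u < x}" using that by auto
    then have 1: "vertex_sign (\<sigma> - {y}) x = vertex_sign \<sigma> x" by (simp add: vertex_sign_def)
    have "{u \<in> \<sigma>. u < y} = insert x {u \<in> \<sigma> - {x}. u < y}" using that by auto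
    then have 2: "vertex_sign \<sigma> y = - vertex_sign (\<sigma> - {x}) y"
      using assms(1) by (simp add: vertex_sign_def)
    show ?thesis by (simp only: 1 2) (simp add: mult.commute)
  qed
  show ?thesis
  proof (cases "v < w")
    case True
    with assms show ?thesis by (intro ordered)
  next
    case False
    with assms have "w < v" by auto
    then show ?thesis using ordered[OF assms(3,2)] by (metis minus_minus)
  qed
qed

lemma simplicial_boundary_of_sign:
  "simplicial_boundary (frag_of \<sigma>) =
    (\<Sum>v\<in>\<sigma>. frag_cmul (vertex_sign \<sigma> v) (frag_of (\<sigma> - {v})))"
  by (simp add: simplicial_boundary_of vertex_sign_def)

lemma simplicial_boundary_0 [simp]: "simplicial_boundary 0 = 0"
  by (simp add: simplicial_boundary_def)

lemma simplicial_boundary_diff: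
  "simplicial_boundary (a - b) = simplicial_boundary a - simplicial_boundary b"
  by (simp add: simplicial_boundary_def frag_extend_diff)

lemma cone_over_0 [simp]: "cone_over v 0 = 0"
  and cone_over_add: "cone_over v (a + b) = cone_over v a + cone_over v b"
  and cone_over_diff: "cone_over v (a - b) = cone_over v a - cone_over v b"
  and cone_over_minus: "cone_over v (- a) = - cone_over v a"
  and cone_over_cmul: "cone_over v (frag_cmul k a) = frag_cmul k (cone_over v a)"
  and cone_over_of: "cone_over v (frag_of \<sigma>) =
    (if v \<in> \<sigma> then 0 else frag_cmul (vertex_sign \<sigma> v) (frag_of (insert v \<sigma>)))"
  by (simp_all add: cone_over_def frag_extend_add frag_extend_diff frag_extend_minus frag_extend_cmul)

lemma cone_over_sum: "cone_over v (sum g I) = (\<Sum>i\<in>I. cone_over v (g i))"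
  by (induction I rule: infinite_finite_induct) (simp_all add: cone_over_add)

lemma contract_to_link_0 [simp]: "contract_to_link v 0 = 0"
  and contract_to_link_add: "contract_to_link v (a + b) = contract_to_link v a + contract_to_link v b"
  and contract_to_link_diff: "contract_to_link v (a - b) = contract_to_link v a - contract_to_link v b"
  and contract_to_link_cmul: "contract_to_link v (frag_cmul k a) = frag_cmul k (contract_to_link v a)"
  and contract_to_link_of: "contract_to_link v (frag_of \<sigma>) =
    (if v \<in> \<sigma> then frag_cmul (vertex_sign \<sigma> v) (frag_of (\<sigma> - {v})) else 0)"
  by (simp_all add: contract_to_link_def frag_extend_add frag_extend_diff frag_extend_cmul)

lemma contract_to_link_sum: "contract_to_link v (sum g I) = (\<Sum>i\<in>I. contract_to_link v (g i))"
  by (induction I rule: infinite_finite_induct) (simp_all add: contract_to_link_add)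

text \<open>
  The cone operator is a chain homotopy from the identity to zero. If \<open>v\<close> is a vertex of the
  simplex, only the face opposite to \<open>v\<close> contributes; otherwise all faces but the front face of
  the cone cancel.
\<close>
lemma boundary_cone_over_of:
  assumes fin: "finite \<sigma>"
  shows "simplicial_boundary (cone_over v (frag_of \<sigma>)) +
    cone_over v (simplicial_boundary (frag_of \<sigma>)) = frag_of \<sigma>"
proof (cases "v \<in> \<sigma>")
  case True
  have "cone_over v (simplicial_boundary (frag_of \<sigma>)) =
      (\<Sum>w\<in>\<sigma>. if w = v then frag_of \<sigma> else 0)"
    unfolding simplicial_boundary_of_sign cone_over_sum
    by (rule sum.cong) (auto simp: cone_over_cmul cone_over_of insert_absorb True)
  also have "\<dots> = frag_of \<sigma>" using fin True by simp
  finally show ?thesis using True by (simp add: cone_over_of)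
next
  case False
  have "frag_cmul (vertex_sign \<sigma> v * vertex_sign (insert v \<sigma>) w) (frag_of (insert v \<sigma> - {w})) =
      - cone_over v (frag_cmul (vertex_sign \<sigma> w) (frag_of (\<sigma> - {w})))" if "w \<in> \<sigma>" for w
  proof -
    have "vertex_sign (insert v \<sigma>) w * vertex_sign (insert v \<sigma> - {w}) v =
        - (vertex_sign (insert v \<sigma>) v * vertex_sign (insert v \<sigma> - {v}) w)"
      using that False fin by (intro vertex_sign_exchange) auto
    moreover have eq: "insert v \<sigma> - {w} = insert v (\<sigma> - {w})" "insert v \<sigma> - {v} = \<sigma>"
      using that False by auto
    ultimately have exch: "vertex_sign (insert v \<sigma>) w * vertex_sign (\<sigma> - {w}) v =
        - (vertex_sign \<sigma> v * vertex_sign \<sigma> w)" by simp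
    have "vertex_sign \<sigma> v * vertex_sign (insert v \<sigma>) w
        = vertex_sign \<sigma> v * (vertex_sign (insert v \<sigma>) w * vertex_sign (\<sigma> - {w}) v)
          * vertex_sign (\<sigma> - {w}) v"
      by (simp add: mult.assoc)
    also have "\<dots> = - (vertex_sign \<sigma> v * vertex_sign \<sigma> v) *
        (vertex_sign \<sigma> w * vertex_sign (\<sigma> - {w}) v)"
      by (simp only: exch) (simp add: algebra_simps)
    finally have "vertex_sign \<sigma> v * vertex_sign (insert v \<sigma>) w =
        - (vertex_sign \<sigma> w * vertex_sign (\<sigma> - {w}) v)" by simp
    then show ?thesis using False by (simp add: cone_over_cmul cone_over_of eq)
  qed
  then have faces: "(\<Sum>w\<in>\<sigma>. frag_cmul (vertex_sign \<sigma> v * vertex_sign (insert v \<sigma>) w)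
      (frag_of (insert v \<sigma> - {w}))) = - cone_over v (simplicial_boundary (frag_of \<sigma>))"
    by (simp add: simplicial_boundary_of_sign cone_over_sum sum_negf)
  have "simplicial_boundary (cone_over v (frag_of \<sigma>)) =
      frag_of \<sigma> + (\<Sum>w\<in>\<sigma>. frag_cmul (vertex_sign \<sigma> v * vertex_sign (insert v \<sigma>) w)
        (frag_of (insert v \<sigma> - {w})))"
    using False fin
    by (simp add: cone_over_of simplicial_boundary_cmul simplicial_boundary_of_sign
        frag_cmul_distrib2 frag_cmul_sum)
  then show ?thesis by (simp add: faces)
qed

lemma contract_to_link_boundary_of:
  assumes fin: "finite \<sigma>"
  shows "contract_to_link v (simplicial_boundary (frag_of \<sigma>)) =
    - simplicial_boundary (contract_to_link v (frag_of \<sigma>))"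
proof (cases "v \<in> \<sigma>")
  case True
  have "frag_cmul (vertex_sign \<sigma> w) (contract_to_link v (frag_of (\<sigma> - {w}))) =
      - frag_cmul (vertex_sign \<sigma> v * vertex_sign (\<sigma> - {v}) w) (frag_of (\<sigma> - {v} - {w}))"
    if "w \<in> \<sigma> - {v}" for w
  proof -
    have "w \<in> \<sigma>" "w \<noteq> v" using that by auto
    have faces_commute: "\<sigma> - {w} - {v} = \<sigma> - {v} - {w}" by auto
    have "contract_to_link v (frag_of (\<sigma> - {w})) =
        frag_cmul (vertex_sign (\<sigma> - {w}) v) (frag_of (\<sigma> - {v} - {w}))"
      using True \<open>w \<noteq> v\<close> by (simp add: contract_to_link_of faces_commute)
    moreover have "vertex_sign \<sigma> w * vertex_sign (\<sigma> - {w}) v =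
        - (vertex_sign \<sigma> v * vertex_sign (\<sigma> - {v}) w)"
      using fin True \<open>w \<in> \<sigma>\<close> \<open>w \<noteq> v\<close> by (intro vertex_sign_exchange) auto
    ultimately show ?thesis by (simp only: frag_cmul_cmul minus_frag_cmul)
  qed
  note face = this
  have "contract_to_link v (simplicial_boundary (frag_of \<sigma>)) =
      (\<Sum>w\<in>\<sigma>. frag_cmul (vertex_sign \<sigma> w) (contract_to_link v (frag_of (\<sigma> - {w}))))"
    by (simp add: simplicial_boundary_of_sign contract_to_link_sum contract_to_link_cmul)
  also have "\<dots> = frag_cmul (vertex_sign \<sigma> v) (contract_to_link v (frag_of (\<sigma> - {v}))) +
      (\<Sum>w\<in>\<sigma> - {v}. frag_cmul (vertex_sign \<sigma> w) (contract_to_link v (frag_of (\<sigma> - {w}))))"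
    by (rule sum.remove[OF fin True])
  also have "contract_to_link v (frag_of (\<sigma> - {v})) = 0"
    by (simp add: contract_to_link_of)
  also have "(\<Sum>w\<in>\<sigma> - {v}. frag_cmul (vertex_sign \<sigma> w) (contract_to_link v (frag_of (\<sigma> - {w})))) =
      (\<Sum>w\<in>\<sigma> - {v}. - frag_cmul (vertex_sign \<sigma> v * vertex_sign (\<sigma> - {v}) w)
        (frag_of (\<sigma> - {v} - {w})))"
    using face by (rule sum.cong[OF refl])
  also have "\<dots> = - simplicial_boundary (contract_to_link v (frag_of \<sigma>))"
    using True by (simp only: sum_negf contract_to_link_of simplicial_boundary_cmul
        simplicial_boundary_of_sign frag_cmul_sum frag_cmul_cmul if_True)
  finally show ?thesis by simp
next
  case False
  then have "contract_to_link v (frag_of (\<sigma> - {w})) = 0" for w by (simp add: contract_to_link_of)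
  with False show ?thesis
    by (simp add: simplicial_boundary_of_sign contract_to_link_sum contract_to_link_cmul)
      (simp add: contract_to_link_of)
qed

lemma boundary_cone_over:
  assumes "is_simplicial_complex K" "Poly_Mapping.keys c \<subseteq> K"
  shows "simplicial_boundary (cone_over v c) + cone_over v (simplicial_boundary c) = c"
  using assms(2)
proof (induction c rule: frag_induction)
  case (one \<sigma>)
  then show ?case
    using assms(1) by (intro boundary_cone_over_of) (auto simp: is_simplicial_complex_def)
next
  case (diff a b)
  then show ?case by (simp add: simplicial_boundary_diff cone_over_diff algebra_simps)
qed simp

lemma contract_to_link_boundary:
  assumes "is_simplicial_complex K" "Poly_Mapping.keys c \<subseteq> K"
  shows "contract_to_link v (simplicial_boundary c) = - simplicial_boundary (contract_to_link v c)"
  using assms(2)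
proof (induction c rule: frag_induction)
  case (one \<sigma>)
  then show ?case
    using assms(1) by (intro contract_to_link_boundary_of) (auto simp: is_simplicial_complex_def)
next
  case (diff a b)
  then show ?case by (simp add: simplicial_boundary_diff contract_to_link_diff)
qed simp

lemma boundary_boundary:
  assumes K: "is_simplicial_complex K" and c: "Poly_Mapping.keys c \<subseteq> K"
  shows "simplicial_boundary (simplicial_boundary c) = 0"
  using c
proof (induction c rule: frag_induction)
  case (one \<sigma>)
  then show ?case
    using K by (intro simplicial_boundary_boundary_of) (auto simp: is_simplicial_complex_def)
next
  case (diff a b)
  then show ?case by (simp add: simplicial_boundary_diff)
qed simp

section \<open>Removing a vertex\<close>

definition vertex_link :: "'a set set \<Rightarrow> 'a \<Rightarrow> 'a set set"
  where "vertex_link K v = {\<sigma>. v \<notin> \<sigma> \<and> insert v \<sigma> \<in> K}"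

definition vertex_deletion :: "'a set set \<Rightarrow> 'a \<Rightarrow> 'a set set"
  where "vertex_deletion K v = {\<sigma> \<in> K. v \<notin> \<sigma>}"

definition pure_boundaries :: "'a::linorder set set \<Rightarrow> bool"
  where "pure_boundaries K \<longleftrightarrow>
    (\<forall>z b m. Poly_Mapping.keys z \<subseteq> K \<longrightarrow> Poly_Mapping.keys b \<subseteq> K \<longrightarrow> m \<noteq> 0 \<longrightarrow>
      frag_cmul m z = simplicial_boundary b \<longrightarrow>
      (\<exists>b'. Poly_Mapping.keys b' \<subseteq> K \<and> z = simplicial_boundary b'))"

lemma is_simplicial_complex_vertex_link:
  assumes "is_simplicial_complex K"
  shows "is_simplicial_complex (vertex_link K v)"
  unfolding is_simplicial_complex_def
proof (intro conjI ballI allI impI)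
  fix \<sigma> assume s: "\<sigma> \<in> vertex_link K v"
  then show "finite \<sigma>"
    using assms by (auto simp: is_simplicial_complex_def vertex_link_def)
  fix \<tau> assume t: "\<tau> \<subseteq> \<sigma>"
  then have "insert v \<tau> \<subseteq> insert v \<sigma>" by auto
  with s t assms show "\<tau> \<in> vertex_link K v"
    unfolding is_simplicial_complex_def vertex_link_def by blast
qed

lemma keys_add_subset:
  "Poly_Mapping.keys a \<subseteq> S \<Longrightarrow> Poly_Mapping.keys b \<subseteq> S \<Longrightarrow> Poly_Mapping.keys (a + b) \<subseteq> S"
  using Poly_Mapping.keys_add[of a b] by blast

lemma keys_diff_subset:
  "Poly_Mapping.keys a \<subseteq> S \<Longrightarrow> Poly_Mapping.keys b \<subseteq> S \<Longrightarrow> Poly_Mapping.keys (a - b) \<subseteq> S"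
  using keys_diff[of a b] by blast

lemma keys_frag_extend_subset:
  assumes "Poly_Mapping.keys c \<subseteq> S" "\<And>x. x \<in> S \<Longrightarrow> Poly_Mapping.keys (f x) \<subseteq> T"
  shows "Poly_Mapping.keys (frag_extend f c) \<subseteq> T"
  using keys_frag_extend[of f c] assms by blast

lemma keys_cone_over:
  assumes "Poly_Mapping.keys c \<subseteq> L" "\<And>\<sigma>. \<sigma> \<in> L \<Longrightarrow> insert w \<sigma> \<in> K"
  shows "Poly_Mapping.keys (cone_over w c) \<subseteq> K"
  unfolding cone_over_def
  by (rule keys_frag_extend_subset[OF assms(1)]) (auto dest: assms(2))

lemma keys_contract_to_link:
  assumes "Poly_Mapping.keys c \<subseteq> K"
  shows "Poly_Mapping.keys (contract_to_link v c) \<subseteq> vertex_link K v"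
  unfolding contract_to_link_def
  by (rule keys_frag_extend_subset[OF assms]) (auto simp: vertex_link_def insert_absorb)

lemma keys_remove_vertex:
  assumes "Poly_Mapping.keys c \<subseteq> K"
  shows "Poly_Mapping.keys (c - cone_over v (contract_to_link v c)) \<subseteq> vertex_deletion K v"
  using assms
proof (induction c rule: frag_induction)
  case (one \<sigma>)
  then show ?case
    by (auto simp: vertex_deletion_def contract_to_link_of cone_over_cmul cone_over_of insert_absorb)
next
  case (diff a b)
  have "a - b - cone_over v (contract_to_link v (a - b)) =
      (a - cone_over v (contract_to_link v a)) - (b - cone_over v (contract_to_link v b))"
    by (simp add: contract_to_link_diff cone_over_diff algebra_simps)
  then show ?case using diff keys_diff_subset by metis
qed simp

text \<open>
  The connecting map from the homology of the link to that of the deletion vanishes, as the link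
  bounds a cone with apex \<open>w\<close> there. On chains: with \<open>m z = \<partial>b\<close>, the link part of \<open>z\<close> is \<open>\<partial>l\<close> by
  purity in the link. The correction \<open>m l + b_l\<close> is a cycle of the link, hence the boundary of its
  cone over \<open>w\<close>, which turns the equation for the deletion part into one to which purity in the
  deletion applies.
\<close>
lemma pure_boundaries_dominated_vertex:
  assumes K: "is_simplicial_complex K" and "w \<noteq> v"
    and dominated: "\<And>\<sigma>. \<sigma> \<in> vertex_link K v \<Longrightarrow> insert w \<sigma> \<in> K"
    and link: "pure_boundaries (vertex_link K v)"
    and deletion: "pure_boundaries (vertex_deletion K v)"
  shows "pure_boundaries K"
  unfolding pure_boundaries_def
proof (intro allI impI)
  fix z b and m :: int
  assume z: "Poly_Mapping.keys z \<subseteq> K" and b: "Poly_Mapping.keys b \<subseteq> K" and m: "m \<noteq> 0"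
    and mz: "frag_cmul m z = simplicial_boundary b"
  let ?L = "vertex_link K v" and ?D = "vertex_deletion K v"
  have L: "is_simplicial_complex ?L" by (rule is_simplicial_complex_vertex_link[OF K])
  have LD: "?L \<subseteq> ?D"
    using K by (auto simp: is_simplicial_complex_def vertex_link_def vertex_deletion_def)
  have DK: "?D \<subseteq> K" by (auto simp: vertex_deletion_def)
  define zl where "zl = contract_to_link v z"
  define bl where "bl = contract_to_link v b"
  define zd where "zd = z - cone_over v zl"
  define bd where "bd = b - cone_over v bl"
  have zl: "Poly_Mapping.keys zl \<subseteq> ?L" and bl: "Poly_Mapping.keys bl \<subseteq> ?L"
    using keys_contract_to_link z b by (auto simp: zl_def bl_def)
  have zd: "Poly_Mapping.keys zd \<subseteq> ?D" and bd: "Poly_Mapping.keys bd \<subseteq> ?D"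
    using keys_remove_vertex z b by (auto simp: zd_def zl_def bd_def bl_def)
  have mzl: "frag_cmul m zl = - simplicial_boundary bl"
    by (simp add: zl_def bl_def mz contract_to_link_boundary[OF K b] flip: contract_to_link_cmul)
  then have "frag_cmul (- m) zl = simplicial_boundary bl"
    by (simp flip: minus_frag_cmul)
  then obtain l where l: "Poly_Mapping.keys l \<subseteq> ?L" and zl_l: "zl = simplicial_boundary l"
    using link zl bl m unfolding pure_boundaries_def by (metis neg_equal_0_iff_equal)
  define y where "y = frag_cmul m l + bl"
  have y: "Poly_Mapping.keys y \<subseteq> ?L"
    unfolding y_def using l bl keys_cmul[of m l] by (intro keys_add_subset) auto
  have "simplicial_boundary y = 0"
    using mzl by (simp add: y_def simplicial_boundary_add simplicial_boundary_cmul zl_l)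
  then have y_cone: "simplicial_boundary (cone_over w y) = y"
    using boundary_cone_over[OF L y, of w] by simp
  have cone_y: "Poly_Mapping.keys (cone_over w y) \<subseteq> ?D"
    using y by (rule keys_cone_over) (use dominated \<open>w \<noteq> v\<close> in
      \<open>auto simp: vertex_deletion_def vertex_link_def\<close>)
  have mzd: "frag_cmul m zd = simplicial_boundary bd + bl"
  proof -
    have "frag_cmul m zd = frag_cmul m z - cone_over v (frag_cmul m zl)"
      unfolding zd_def using frag_cmul_distrib2[of m "z - cone_over v zl" "cone_over v zl"]
      by (simp add: cone_over_cmul)
    also have "\<dots> = simplicial_boundary b + cone_over v (simplicial_boundary bl)"
      by (simp add: mz mzl cone_over_minus)
    also have "\<dots> = simplicial_boundary bd + bl"
      using boundary_cone_over[OF L bl, of v]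
      by (simp add: bd_def simplicial_boundary_diff algebra_simps)
    finally show ?thesis .
  qed
  have "frag_cmul m (zd + l) = simplicial_boundary (bd + cone_over w y)"
    by (simp add: simplicial_boundary_add y_cone frag_cmul_distrib2 mzd) (simp add: y_def)
  moreover have "Poly_Mapping.keys (zd + l) \<subseteq> ?D" "Poly_Mapping.keys (bd + cone_over w y) \<subseteq> ?D"
    using zd bd l LD cone_y by (intro keys_add_subset; blast)+
  ultimately obtain d where d: "Poly_Mapping.keys d \<subseteq> ?D"
    and zd_l: "zd + l = simplicial_boundary d"
    using deletion m unfolding pure_boundaries_def by metis
  have cone_l: "Poly_Mapping.keys (cone_over v l) \<subseteq> K"
    using l by (rule keys_cone_over) (auto simp: vertex_link_def)
  have "z = zd + cone_over v (simplicial_boundary l)"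
    by (simp add: zd_def zl_l)
  also have "\<dots> = simplicial_boundary (d - cone_over v l)"
    using boundary_cone_over[OF L l, of v] zd_l
    by (simp add: simplicial_boundary_diff algebra_simps)
  finally show "\<exists>b'. Poly_Mapping.keys b' \<subseteq> K \<and> z = simplicial_boundary b'"
    using keys_diff_subset[of d K "cone_over v l"] d DK cone_l by blast
qed

lemma pure_boundaries_cone:
  assumes K: "is_simplicial_complex K" and apex: "\<And>\<sigma>. \<sigma> \<in> K \<Longrightarrow> insert v \<sigma> \<in> K"
  shows "pure_boundaries K"
  unfolding pure_boundaries_def
proof (intro allI impI)
  fix z b and m :: int
  assume z: "Poly_Mapping.keys z \<subseteq> K" and b: "Poly_Mapping.keys b \<subseteq> K" and m: "m \<noteq> 0"
    and mz: "frag_cmul m z = simplicial_boundary b"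
  have "frag_cmul m (simplicial_boundary z) = 0"
    by (simp only: mz boundary_boundary[OF K b] flip: simplicial_boundary_cmul)
  then have "simplicial_boundary z = 0" using m by simp
  then have "z = simplicial_boundary (cone_over v z)" using boundary_cone_over[OF K z, of v] by simp
  moreover have "Poly_Mapping.keys (cone_over v z) \<subseteq> K" using z apex by (rule keys_cone_over)
  ultimately show "\<exists>b'. Poly_Mapping.keys b' \<subseteq> K \<and> z = simplicial_boundary b'" by blast
qed

lemma pure_boundaries_no_vertices:
  assumes "K \<subseteq> {{}}"
  shows "pure_boundaries K"
  unfolding pure_boundaries_def
proof (intro allI impI)
  fix z b and m :: int
  assume b: "Poly_Mapping.keys b \<subseteq> K" and m: "m \<noteq> 0"
    and mz: "frag_cmul m z = simplicial_boundary b"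
  have "simplicial_boundary b = 0"
    unfolding simplicial_boundary_def using b assms by (intro frag_extend_eq_0) auto
  then have "z = 0" using m mz by simp
  then show "\<exists>b'. Poly_Mapping.keys b' \<subseteq> K \<and> z = simplicial_boundary b'"
    by (intro exI[of _ 0]) simp
qed

section \<open>Complexes of coprime prime powers\<close>

definition coprime_complex :: "nat set \<Rightarrow> nat \<Rightarrow> nat set set"
  where "coprime_complex S n = {\<sigma>. \<sigma> \<subseteq> S \<and> pairwise coprime \<sigma> \<and> \<Prod>\<sigma> \<le> n}"

lemma is_simplicial_complex_coprime_complex:
  assumes S: "finite S" "\<And>s. s \<in> S \<Longrightarrow> s > 0"
  shows "is_simplicial_complex (coprime_complex S n)"
  unfolding is_simplicial_complex_def
proof (intro conjI ballI allI impI)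
  fix \<sigma> assume s: "\<sigma> \<in> coprime_complex S n"
  then have sub: "\<sigma> \<subseteq> S" by (auto simp: coprime_complex_def)
  show fin: "finite \<sigma>" using sub S(1) by (rule finite_subset)
  fix \<tau> assume t: "\<tau> \<subseteq> \<sigma>"
  have "\<Prod>\<tau> dvd \<Prod>\<sigma>" using fin t by (rule prod_dvd_prod_subset)
  moreover have "\<Prod>\<sigma> > 0" using sub S(2) by (intro prod_pos) auto
  ultimately have "\<Prod>\<tau> \<le> \<Prod>\<sigma>" by (rule dvd_imp_le)
  with s t show "\<tau> \<in> coprime_complex S n"
    by (auto simp: coprime_complex_def intro: pairwise_subset)
qed

lemma vertex_deletion_coprime_complex:
  "vertex_deletion (coprime_complex S n) v = coprime_complex (S - {v}) n"
  by (auto simp: vertex_deletion_def coprime_complex_def)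

lemma vertex_link_coprime_complex:
  assumes "finite S" "v \<in> S" "v > 0"
  shows "vertex_link (coprime_complex S n) v = coprime_complex {s \<in> S - {v}. coprime v s} (n div v)"
    (is "?lhs = ?rhs")
proof (rule Set.set_eqI)
  fix \<sigma>
  have "\<Prod>(insert v \<sigma>) \<le> n \<longleftrightarrow> \<Prod>\<sigma> \<le> n div v" if "v \<notin> \<sigma>" "\<sigma> \<subseteq> S"
  proof -
    have "finite \<sigma>" using assms(1) that finite_subset by blast
    then show ?thesis
      using that assms(3) by (simp add: less_eq_div_iff_mult_less_eq mult.commute)
  qed
  moreover have "pairwise coprime (insert v \<sigma>) \<longleftrightarrow>
      pairwise coprime \<sigma> \<and> (\<forall>s\<in>\<sigma>. coprime v s)" if "v \<notin> \<sigma>"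
    using that by (auto simp: pairwise_insert coprime_commute)
  ultimately show "\<sigma> \<in> ?lhs \<longleftrightarrow> \<sigma> \<in> ?rhs"
    using assms(2) by (auto simp: vertex_link_def coprime_complex_def)
qed

text \<open>
  The coprimality condition is required away from \<open>w\<close> only, since \<open>w\<close> may already belong to the
  simplex; adding it then changes nothing.
\<close>
lemma insert_smaller_vertex:
  assumes "finite S" "v \<in> S" "w \<in> S" "w < v"
    and coprime: "\<And>s. s \<in> S - {v, w} \<Longrightarrow> coprime v s \<Longrightarrow> coprime w s"
    and \<sigma>: "\<sigma> \<in> vertex_link (coprime_complex S n) v"
  shows "insert w \<sigma> \<in> coprime_complex S n"
proof -
  have "\<sigma> \<subseteq> S" "v \<notin> \<sigma>" "pairwise coprime (insert v \<sigma>)" "\<Prod>(insert v \<sigma>) \<le> n"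
    using \<sigma> by (auto simp: vertex_link_def coprime_complex_def)
  have fin: "finite \<sigma>" using \<open>\<sigma> \<subseteq> S\<close> assms(1) by (rule finite_subset)
  have "pairwise coprime \<sigma>" and "\<forall>s\<in>\<sigma>. coprime v s"
    using \<open>pairwise coprime (insert v \<sigma>)\<close> \<open>v \<notin> \<sigma>\<close> by (auto simp: pairwise_insert)
  then have "pairwise coprime (insert w \<sigma>)"
    using coprime \<open>\<sigma> \<subseteq> S\<close> \<open>v \<notin> \<sigma>\<close> by (auto simp: pairwise_insert coprime_commute)
  moreover have "\<Prod>(insert w \<sigma>) \<le> v * \<Prod>\<sigma>"
    using fin assms(4) by (cases "w \<in> \<sigma>") (auto simp: insert_absorb)
  ultimately show ?thesis
    using \<open>\<Prod>(insert v \<sigma>) \<le> n\<close> \<open>v \<notin> \<sigma>\<close> \<open>\<sigma> \<subseteq> S\<close> assms(3) fin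
    by (simp add: coprime_complex_def)
qed

lemma coprime_primepow_transfer:
  fixes v w s :: nat
  assumes "primepow v" "primepow w" "\<not> coprime v w" "coprime v s"
  shows "coprime w s"
proof -
  obtain p k where p: "prime p" "k > 0" "v = p ^ k"
    using assms(1) by (auto simp: primepow_def)
  obtain q l where q: "prime q" "l > 0" "w = q ^ l"
    using assms(2) by (auto simp: primepow_def)
  have "p = q"
    using assms(3) p q primes_coprime[of p q] by auto
  then show ?thesis using assms(4) p q by simp
qed

lemma obtain_dominated_vertex:
  fixes S :: "nat set"
  assumes S: "S \<subseteq> {q. primepow q}" and "x \<in> S" "y \<in> S" "x \<noteq> y"
  obtains v w where "v \<in> S" "w \<in> S" "w < v"
    "\<And>s. s \<in> S - {v, w} \<Longrightarrow> coprime v s \<Longrightarrow> coprime w s"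
proof (cases "pairwise coprime S")
  case True
  have "max x y \<in> S" "min x y \<in> S" "min x y < max x y"
    using assms by (auto simp: max_def min_def)
  then show thesis using True by (intro that[of "max x y" "min x y"]) (auto simp: pairwise_def)
next
  case False
  then obtain a b where ab: "a \<in> S" "b \<in> S" "a \<noteq> b" "\<not> coprime a b"
    by (auto simp: pairwise_def)
  then have "\<exists>v w. v \<in> S \<and> w \<in> S \<and> w < v \<and> \<not> coprime v w"
    by (metis coprime_commute linorder_neqE_nat)
  then obtain v w where vw: "v \<in> S" "w \<in> S" "w < v" "\<not> coprime v w" by blast
  then show thesis
    using S coprime_primepow_transfer[of v w] by (intro that[of v w]) auto
qed

lemma pure_boundaries_coprime_complex:
  assumes "finite S" "S \<subseteq> {q. primepow q}"
  shows "pure_boundaries (coprime_complex S n)"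
  using assms
proof (induction S arbitrary: n rule: finite_psubset_induct)
  case (psubset S)
  have pos: "s > 0" if "s \<in> S" for s
    using psubset.prems that by (auto intro: primepow_gt_0_nat)
  have K: "is_simplicial_complex (coprime_complex S n)"
    using psubset.hyps pos by (rule is_simplicial_complex_coprime_complex)
  show ?case
  proof (cases "\<exists>x\<in>S. \<exists>y\<in>S. x \<noteq> y")
    case True
    then obtain v w where vw: "v \<in> S" "w \<in> S" "w < v"
      and dom: "\<And>s. s \<in> S - {v, w} \<Longrightarrow> coprime v s \<Longrightarrow> coprime w s"
      using obtain_dominated_vertex[OF psubset.prems] by metis
    have "pure_boundaries (vertex_link (coprime_complex S n) v)"
      unfolding vertex_link_coprime_complex[OF psubset.hyps vw(1) pos[OF vw(1)]]
      using vw psubset.prems by (intro psubset.IH) auto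
    moreover have "pure_boundaries (vertex_deletion (coprime_complex S n) v)"
      unfolding vertex_deletion_coprime_complex
      using vw psubset.prems by (intro psubset.IH) auto
    ultimately show ?thesis
      using insert_smaller_vertex[OF psubset.hyps vw dom] vw(3)
      by (intro pure_boundaries_dominated_vertex[OF K, of w v]) auto
  next
    case False
    show ?thesis
    proof (cases "\<exists>v\<in>S. {v} \<in> coprime_complex S n")
      case True
      then obtain v where v: "v \<in> S" "{v} \<in> coprime_complex S n" by blast
      then have "S = {v}" using False by auto
      then have "insert v \<sigma> = {v}" if "\<sigma> \<in> coprime_complex S n" for \<sigma>
        using that by (auto simp: coprime_complex_def)
      then show ?thesis using v by (intro pure_boundaries_cone[OF K, of v]) metis
    next
      case no_vertex: False
      have "\<sigma> = {}" if "\<sigma> \<in> coprime_complex S n" for \<sigma>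
      proof (rule ccontr)
        assume "\<sigma> \<noteq> {}"
        then obtain v where "v \<in> \<sigma>" by blast
        then have "{v} \<subseteq> \<sigma>" by blast
        then have face: "{v} \<in> coprime_complex S n"
          using that K unfolding is_simplicial_complex_def by blast
        moreover from face have "v \<in> S" by (simp add: coprime_complex_def)
        ultimately show False using no_vertex by blast
      qed
      then show ?thesis by (intro pure_boundaries_no_vertices) auto
    qed
  qed
qed

section \<open>Pure boundaries and torsion in homology\<close>

text \<open>
  Only the part of a chain in dimension \<open>p + 1\<close> contributes to its boundary in dimension \<open>p\<close>, so
  that purity for chains of mixed dimension gives purity in each dimension.
\<close>
lemma boundary_dimension_part:
  assumes K: "is_simplicial_complex K" and b: "Poly_Mapping.keys b \<subseteq> K"
    and z: "Poly_Mapping.keys (simplicial_boundary b) \<subseteq> simplices_of_dim K p"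
  obtains b' where "Poly_Mapping.keys b' \<subseteq> simplices_of_dim K (p + 1)"
    "simplicial_boundary b' = simplicial_boundary b"
proof -
  have "Poly_Mapping.keys b \<subseteq> simplices_of_dim K (p + 1) \<union> (K - simplices_of_dim K (p + 1))"
    using b by blast
  then obtain d e where d: "Poly_Mapping.keys d \<subseteq> simplices_of_dim K (p + 1)"
    and e: "Poly_Mapping.keys e \<subseteq> K - simplices_of_dim K (p + 1)" and de: "d + e = b"
    by (rule frag_split)
  have bd: "Poly_Mapping.keys (simplicial_boundary d) \<subseteq> simplices_of_dim K p"
    using hom_in_carrier[OF simplicial_boundary_hom[OF K, of "p + 1"], of d] d
    by (simp add: simplicial_chain_group_def)
  have "Poly_Mapping.keys (simplicial_boundary e) \<subseteq> - simplices_of_dim K p"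
    unfolding simplicial_boundary_def
  proof (rule keys_frag_extend_subset[OF e])
    fix \<sigma> assume s: "\<sigma> \<in> K - simplices_of_dim K (p + 1)"
    then have fin: "finite \<sigma>" using K by (auto simp: is_simplicial_complex_def)
    have "\<sigma> - {v} \<notin> simplices_of_dim K p" if "v \<in> \<sigma>" for v
    proof
      assume "\<sigma> - {v} \<in> simplices_of_dim K p"
      then have "int (Suc (card (\<sigma> - {v}))) = p + 1 + 1" by (simp add: simplices_of_dim_def)
      then have "int (card \<sigma>) = p + 1 + 1" by (simp only: card.remove[OF fin that])
      then show False using s by (simp add: simplices_of_dim_def)
    qed
    then show "Poly_Mapping.keys (\<Sum>v\<in>\<sigma>. frag_cmul ((-1) ^ card {u \<in> \<sigma>. u < v})
        (frag_of (\<sigma> - {v}))) \<subseteq> - simplices_of_dim K p"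
      by (intro order_trans[OF Poly_Mapping.keys_sum]) auto
  qed
  moreover have "simplicial_boundary e = simplicial_boundary b - simplicial_boundary d"
    by (simp add: simplicial_boundary_add flip: de)
  then have "Poly_Mapping.keys (simplicial_boundary e) \<subseteq> simplices_of_dim K p"
    using z bd by (simp add: keys_diff_subset)
  ultimately have "Poly_Mapping.keys (simplicial_boundary e) = {}" by blast
  then have "simplicial_boundary d = simplicial_boundary b"
    by (simp add: simplicial_boundary_add flip: de)
  with d show thesis by (rule that)
qed

lemma torsion_free_homology_if_pure_boundaries:
  assumes K: "is_simplicial_complex K" and pure: "pure_boundaries K"
  shows "torsion_free_group (reduced_simplicial_homology_group K p)"
  unfolding torsion_free_group_def
proof (intro ballI allI impI)
  let ?Z = "subgroup_generated (simplicial_chain_group K p) (simplicial_cycles K p)"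
  let ?B = "simplicial_boundaries K p"
  interpret B: normal ?B ?Z by (rule simplicial_boundaries_normal[OF K])
  fix x and m :: nat
  assume x: "x \<in> carrier (reduced_simplicial_homology_group K p)" and m: "m > 0"
    and xm: "x [^]\<^bsub>reduced_simplicial_homology_group K p\<^esub> m =
      \<one>\<^bsub>reduced_simplicial_homology_group K p\<^esub>"
  obtain z where z: "z \<in> carrier ?Z" and xz: "x = ?B #>\<^bsub>?Z\<^esub> z"
    using x by (auto simp: reduced_simplicial_homology_group_def carrier_FactGroup)
  have zp: "Poly_Mapping.keys z \<subseteq> simplices_of_dim K p"
    using z unfolding carrier_simplicial_cycle_group[OF K]
    by (simp add: simplicial_cycles_def kernel_def simplicial_chain_group_def)
  have zm: "z [^]\<^bsub>?Z\<^esub> m = frag_cmul (int m) z"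
    unfolding pow_subgroup_generated simplicial_chain_group_def by (rule pow_free_Abelian_group)
  have "?B #>\<^bsub>?Z\<^esub> (z [^]\<^bsub>?Z\<^esub> m) = ?B"
    using xm B.FactGroup_pow[OF z, of m] by (simp add: reduced_simplicial_homology_group_def xz)
  then have "frag_cmul (int m) z \<in> ?B"
    unfolding zm [symmetric]
    using B.coset_join1[OF _ B.nat_pow_closed[OF z] B.subgroup_axioms] B.subset by blast
  then obtain b where b: "Poly_Mapping.keys b \<subseteq> simplices_of_dim K (p + 1)"
    and mz: "frag_cmul (int m) z = simplicial_boundary b"
    by (auto simp: simplicial_boundaries_def simplicial_chain_group_def)
  have "Poly_Mapping.keys z \<subseteq> K" "Poly_Mapping.keys b \<subseteq> K"
    using zp b by (auto simp: simplices_of_dim_def)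
  then obtain c where c: "Poly_Mapping.keys c \<subseteq> K" and zc: "z = simplicial_boundary c"
    using pure m mz unfolding pure_boundaries_def by (metis of_nat_eq_0_iff less_irrefl)
  obtain c' where "Poly_Mapping.keys c' \<subseteq> simplices_of_dim K (p + 1)"
    "simplicial_boundary c' = z"
    using boundary_dimension_part[OF K c] zp zc by metis
  then have "z \<in> ?B"
    by (auto simp: simplicial_boundaries_def simplicial_chain_group_def)
  then show "x = \<one>\<^bsub>reduced_simplicial_homology_group K p\<^esub>"
    using B.coset_join2[OF z B.subgroup_axioms]
    by (simp add: xz reduced_simplicial_homology_group_def)
qed

theorem mainTheorem4:
  fixes n :: nat and p :: int
  assumes "n \<ge> 1"
  shows "torsion_free_group (reduced_simplicial_homology_group (prime_power_complex n) p)"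
proof -
  have "prime_power_complex n = coprime_complex ({1..n} \<inter> {q. primepow q}) n"
    by (simp add: prime_power_complex_def coprime_complex_def)
  then have "pure_boundaries (prime_power_complex n)"
    by (simp add: pure_boundaries_coprime_complex)
  then show ?thesis
    by (rule torsion_free_homology_if_pure_boundaries
        [OF is_simplicial_complex_prime_power_complex])
qed

end
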